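(* Let $\boldsymbol{\alpha}=(\alpha_i)_{i\ge1}$ be algebraic indeterminates. Let $g_{-1}(t)=1$, let $$g_0(t)\;=\;\cfrac{1}{1-\cfrac{\alpha_1 t}{1-\cfrac{\alpha_2 t}{1-\cdots}}}\,,$$ and let the formal power series $(g_k(t))_{k\ge-1}$ satisfy the recurrence $$g_k(t)-g_{k-1}(t)\;=\;\alpha_{k+1}\,t\,g_{k+1}(t)\qquad\text{for } k\ge0.$$ Write $g_k(t)=\sum_{n=0}^\infty g_{k,n}t^n$. Then for all integers $j,n\ge0$, $$g_{2j,n}\;=\;S_{n+j,j}(\boldsymbol{\alpha}),\qquad g_{2j+1,n}\;=\;S'_{n+j,j}(\boldsymbol{\alpha}),$$ where $S_{n,k}(\boldsymbol{\alpha})$ and $S'_{n,k}(\boldsymbol{\alpha})$ are the generalized Stieltjes–Rogers polynomials of the first and second kind, respectively.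
   Context: The infinite continued fraction is understood as a formal power series in $t$ with coefficients in $\mathbb{Z}[\boldsymbol{\alpha}]$ (the coefficientwise limit of its truncations). A partial Dyck path is a path in $\mathbb{Z}\times\mathbb{N}$ (with $\mathbb{N}=\{0,1,2,\ldots\}$), starting on the horizontal axis and ending anywhere, using the steps $(1,1)$ ("rise") and $(1,-1)$ ("fall"). The weight of a path is the product of its step weights, where each rise gets weight $1$ and each fall starting at height $i$ gets weight $\alpha_i$. The generalized Stieltjes–Rogers polynomial of the first kind $S_{n,k}(\boldsymbol{\alpha})$ is the sum of the weights of all partial Dyck paths from $(0,0)$ to $(2n,2k)$. The generalized Stieltjes–Rogers polynomial of the second kind $S'_{n,k}(\boldsymbol{\alpha})$ is the sum of the weights of all partial Dyck paths from $(0,0)$ to $(2n+1,2k+1)$. *)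

theory Defs
  imports
    "HOL-Computational_Algebra.Formal_Power_Series"
    "HOL-Library.Poly_Mapping"
begin

text \<open>
  The polynomial ring \<open>\<int>[\<alpha>\<^sub>1, \<alpha>\<^sub>2, \<dots>]\<close>: a monomial is a finitely supported
  exponent vector, a polynomial a finitely supported integer-valued function on monomials. The
  exponent of \<open>\<alpha>\<^sub>i\<close> is stored at position \<open>i - 1\<close>, so that the ring contains no
  indeterminates besides \<open>\<alpha>\<^sub>1, \<alpha>\<^sub>2, \<dots>\<close>; accordingly \<open>alpha i\<close> is meaningful only for \<open>i \<ge> 1\<close>.
\<close>

type_synonym zalpha = "(nat \<Rightarrow>\<^sub>0 nat) \<Rightarrow>\<^sub>0 int"

definition alpha :: "nat \<Rightarrow> zalpha" where
  "alpha i = Poly_Mapping.single (Poly_Mapping.single (i - 1) 1) 1"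


subsection \<open>Partial Dyck paths and generalized Stieltjes--Rogers polynomials\<close>

text \<open>A path is the list of the points of \<open>\<int> \<times> \<nat>\<close> it visits, its endpoints included.\<close>

definition dyck_step :: "int \<times> nat \<Rightarrow> int \<times> nat \<Rightarrow> bool" where
  "dyck_step p q \<longleftrightarrow> fst q = fst p + 1 \<and> (snd q = snd p + 1 \<or> snd p = snd q + 1)"

definition partial_dyck_path :: "(int \<times> nat) list \<Rightarrow> bool" where
  "partial_dyck_path ps \<longleftrightarrow> ps \<noteq> [] \<and> snd (hd ps) = 0 \<and> successively dyck_step ps"

definition step_weight :: "(nat \<Rightarrow> 'a::comm_ring_1) \<Rightarrow> int \<times> nat \<Rightarrow> int \<times> nat \<Rightarrow> 'a" where
  "step_weight a p q = (if snd q < snd p then a (snd p) else 1)"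

fun path_weight :: "(nat \<Rightarrow> 'a::comm_ring_1) \<Rightarrow> (int \<times> nat) list \<Rightarrow> 'a" where
  "path_weight a (p # q # ps) = step_weight a p q * path_weight a (q # ps)"
| "path_weight a [p] = 1"
| "path_weight a [] = 1"

definition dyck_paths_to :: "int \<times> nat \<Rightarrow> (int \<times> nat) list set" where
  "dyck_paths_to z = {ps. partial_dyck_path ps \<and> hd ps = (0, 0) \<and> last ps = z}"

definition SR1 :: "(nat \<Rightarrow> 'a::comm_ring_1) \<Rightarrow> nat \<Rightarrow> nat \<Rightarrow> 'a" where
  "SR1 a n k = (\<Sum>ps \<in> dyck_paths_to (2 * int n, 2 * k). path_weight a ps)"

definition SR2 :: "(nat \<Rightarrow> 'a::comm_ring_1) \<Rightarrow> nat \<Rightarrow> nat \<Rightarrow> 'a" where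
  "SR2 a n k = (\<Sum>ps \<in> dyck_paths_to (2 * int n + 1, 2 * k + 1). path_weight a ps)"

lemma finite_dyck_paths_from:
  "finite {ps. ps \<noteq> [] \<and> successively dyck_step ps \<and> hd ps = p \<and> last ps = z
             \<and> length ps = Suc n}"
proof (induction n arbitrary: p)
  case 0
  have "{ps. ps \<noteq> [] \<and> successively dyck_step ps \<and> hd ps = p \<and> last ps = z
             \<and> length ps = Suc 0} \<subseteq> {[p]}"
    by (auto simp: length_Suc_conv)
  then show ?case
    by (rule finite_subset) simp
next
  case (Suc n)
  let ?F = "\<lambda>p n. {ps. ps \<noteq> [] \<and> successively dyck_step ps \<and> hd ps = p \<and> last ps = z
             \<and> length ps = Suc n}"
  have "?F p (Suc n) \<subseteq> (\<lambda>qs. p # qs) `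
      (?F (fst p + 1, snd p + 1) n \<union> ?F (fst p + 1, snd p - 1) n)"
  proof
    fix ps assume ps: "ps \<in> ?F p (Suc n)"
    then obtain q qs where eq: "ps = p # q # qs"
      by (auto simp: length_Suc_conv)
    have "q = (fst p + 1, snd p + 1) \<or> q = (fst p + 1, snd p - 1)"
      using ps eq by (cases q) (auto simp: dyck_step_def)
    then show "ps \<in> (\<lambda>qs. p # qs) `
      (?F (fst p + 1, snd p + 1) n \<union> ?F (fst p + 1, snd p - 1) n)"
      using ps eq by auto
  qed
  then show ?case
    using Suc.IH by (meson finite_UnI finite_imageI finite_subset)
qed

lemma successively_dyck_step_fst_last:
  "successively dyck_step ps \<Longrightarrow> ps \<noteq> [] \<Longrightarrow> fst (last ps) = fst (hd ps) + int (length ps) - 1"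
proof (induction ps)
  case (Cons p ps)
  then show ?case
    by (cases ps) (auto simp: dyck_step_def)
qed simp

lemma finite_dyck_paths_to: "finite (dyck_paths_to z)"
proof (rule finite_subset)
  show "dyck_paths_to z \<subseteq> {ps. ps \<noteq> [] \<and> successively dyck_step ps \<and> hd ps = (0, 0)
      \<and> last ps = z \<and> length ps = Suc (nat (fst z))}"
  proof
    fix ps assume "ps \<in> dyck_paths_to z"
    then have ps: "ps \<noteq> []" "successively dyck_step ps" "hd ps = (0, 0)" "last ps = z"
      by (simp_all add: dyck_paths_to_def partial_dyck_path_def)
    have "length ps = Suc (nat (fst z))"
      using successively_dyck_step_fst_last[OF ps(2,1)] ps by (cases ps) auto
    then show "ps \<in> {ps. ps \<noteq> [] \<and> successively dyck_step ps \<and> hd ps = (0, 0)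
      \<and> last ps = z \<and> length ps = Suc (nat (fst z))}"
      using ps by simp
  qed
qed (rule finite_dyck_paths_from)


subsection \<open>Stieltjes-type continued fractions\<close>

text \<open>
  The truncation of depth \<open>N\<close> of the continued fraction whose first numerator is \<open>a i * t\<close>:
  it involves \<open>a i, \<dots>, a (i + N - 1)\<close>, and the remaining tail is replaced by \<open>1\<close>. Since the
  coefficient ring is not a field, the reciprocal is \<^const>\<open>fps_right_inverse_constructor\<close>
  at constant coefficient \<open>1\<close>.
\<close>

fun scf_trunc :: "(nat \<Rightarrow> 'a::comm_ring_1) \<Rightarrow> nat \<Rightarrow> nat \<Rightarrow> 'a fps" where
  "scf_trunc a i 0 = 1"
| "scf_trunc a i (Suc N) =
     fps_right_inverse (1 - fps_const (a i) * fps_X * scf_trunc a (Suc i) N) 1"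

text \<open>
  Limits of formal power series are coefficientwise with eventual equality of
  each coefficient: see \<open>tendsto_fps_iff\<close>.
\<close>

definition scf :: "(nat \<Rightarrow> 'a::comm_ring_1) \<Rightarrow> 'a fps" where
  "scf a = lim (\<lambda>N. scf_trunc a 1 N)"

lemma scf_trunc_Suc_mult:
  "(1 - fps_const (a i) * fps_X * scf_trunc a (Suc i) N) * scf_trunc a i (Suc N) = 1"
  unfolding scf_trunc.simps by (subst fps_right_inverse) (auto simp: mult.assoc)

lemma scf_trunc_diff_dvd: "fps_X ^ Suc N dvd scf_trunc a i (Suc N) - scf_trunc a i N"
proof (induction N arbitrary: i)
  case 0
  define u where "u = scf_trunc a i (Suc 0)"
  have "(1 - fps_const (a i) * fps_X) * u = 1"
    using scf_trunc_Suc_mult[of a i 0] by (simp add: u_def del: scf_trunc.simps(2))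
  then have "u - 1 = fps_X * (fps_const (a i) * u)"
    by (simp add: algebra_simps)
  then show ?case
    by (simp add: u_def del: scf_trunc.simps(2))
next
  case (Suc N)
  define c where "c = fps_const (a i)"
  define u u' where "u = scf_trunc a i (Suc N)" and "u' = scf_trunc a i (Suc (Suc N))"
  define v v' where "v = scf_trunc a (Suc i) N" and "v' = scf_trunc a (Suc i) (Suc N)"
  have 1: "(1 - c * fps_X * v) * u = 1" and 2: "(1 - c * fps_X * v') * u' = 1"
    unfolding c_def u_def v_def u'_def v'_def by (rule scf_trunc_Suc_mult)+
  have "u' - u = u' * ((1 - c * fps_X * v) * u) - u * ((1 - c * fps_X * v') * u')"
    by (simp only: 1 2) simp
  also have "\<dots> = fps_X * (v' - v) * (u * u' * c)"
    by (simp add: algebra_simps)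
  finally have *: "u' - u = fps_X * (v' - v) * (u * u' * c)" .
  have "fps_X ^ Suc N dvd v' - v"
    unfolding v_def v'_def by (rule Suc.IH)
  then have "fps_X * fps_X ^ Suc N dvd u' - u"
    unfolding * by (intro dvd_mult2 mult_dvd_mono) auto
  then show ?case
    by (simp add: u_def u'_def del: scf_trunc.simps(2))
qed

lemma scf_trunc_nth_stable:
  assumes "n \<le> N" shows "fps_nth (scf_trunc a i N) n = fps_nth (scf_trunc a i n) n"
  using assms
proof (induction N rule: dec_induct)
  case (step N)
  obtain h where "scf_trunc a i (Suc N) - scf_trunc a i N = fps_X ^ Suc N * h"
    using scf_trunc_diff_dvd[of N a i] by (auto elim: dvdE)
  then have "fps_nth (scf_trunc a i (Suc N) - scf_trunc a i N) n = 0"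
    using step.hyps by (simp only: fps_X_power_mult_nth) simp
  then show ?case
    using step.IH by simp
qed simp

lemma scf_trunc_tendsto: "(\<lambda>N. scf_trunc a 1 N) \<longlonglongrightarrow> scf a"
proof -
  have "(\<lambda>N. scf_trunc a 1 N) \<longlonglongrightarrow> Abs_fps (\<lambda>n. fps_nth (scf_trunc a 1 n) n)"
    unfolding tendsto_fps_iff
    by (auto intro!: eventually_sequentiallyI scf_trunc_nth_stable)
  then show ?thesis
    unfolding scf_def by (simp add: convergent_LIMSEQ_iff[symmetric] convergentI)
qed

end

theory Submission
  imports Defs
begin

text \<open>
  Write \<open>P m h\<close> for the total weight of the partial Dyck paths from \<open>(0, 0)\<close> to \<open>(m, h)\<close>. Both
  families of Stieltjes--Rogers polynomials are values of \<open>P\<close>, and the two claims are the cases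
  \<open>k = 2 j\<close> and \<open>k = 2 j + 1\<close> of the single identity \<open>g\<^bsub>k,n\<^esub> = P (2 n + k) k\<close>.

  This identity holds because both sides obey the same recursion. The last step of a path that
  ends at \<open>(m + 1, h)\<close> is a rise from height \<open>h - 1\<close>, of weight \<open>1\<close>, or a fall from height \<open>h + 1\<close>,
  of weight \<open>\<alpha>\<^bsub>h+1\<^esub>\<close>; hence \<open>P (m + 1) h = P m (h - 1) + \<alpha>\<^bsub>h+1\<^esub> * P m (h + 1)\<close>
  (lemma \<open>path_sum_Suc\<close>). At \<open>m + 1 = 2 n + k\<close> and \<open>h = k\<close> the two terms on the right are the
  values of \<open>P\<close> attached to the index pairs \<open>(k - 1, n)\<close> and \<open>(k + 1, n - 1)\<close> (for \<open>n = 0\<close> the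
  second term is \<open>0\<close>), and the coefficient of \<open>t\<^sup>n\<close> in the recurrence for the series is
  \<open>g\<^bsub>k,n\<^esub> = g\<^bsub>k-1,n\<^esub> + \<alpha>\<^bsub>k+1\<^esub> * g\<^bsub>k+1,n-1\<^esub>\<close>. Every
  coefficient is thereby expressed through one with smaller \<open>n\<close> and one with the same \<open>n\<close> and
  smaller \<open>k\<close>, so an induction on \<open>n\<close>, with an inner induction on \<open>k\<close>, proves equality once the
  boundary values agree. The boundary series \<open>g\<^bsub>-1\<^esub> = 1\<close> accounts for the empty path at
  \<open>(0, 0)\<close> and for the absence of rises from below the axis.
\<close>

definition path_sum :: "(nat \<Rightarrow> 'a::comm_ring_1) \<Rightarrow> nat \<Rightarrow> nat \<Rightarrow> 'a" where
  "path_sum a m h = (\<Sum>ps \<in> dyck_paths_to (int m, h). path_weight a ps)"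

lemma path_weight_snoc:
  "ps \<noteq> [] \<Longrightarrow> path_weight a (ps @ [q]) = path_weight a ps * step_weight a (last ps) q"
proof (induction ps)
  case (Cons p ps)
  then show ?case
    by (cases ps) (auto simp: mult.assoc)
qed simp

lemma length_dyck_path:
  assumes "ps \<in> dyck_paths_to (int m, h)"
  shows "length ps = Suc m"
  using assms successively_dyck_step_fst_last[of ps]
  by (auto simp: dyck_paths_to_def partial_dyck_path_def)

lemma dyck_paths_to_0: "dyck_paths_to (0, h) = (if h = 0 then {[(0, 0)]} else {})"
proof -
  have "dyck_paths_to (0, h) \<subseteq> (if h = 0 then {[(0, 0)]} else {})"
  proof
    fix ps assume ps: "ps \<in> dyck_paths_to (0, h)"
    have "ps = [(0, 0)] \<and> h = 0"
      using ps length_dyck_path[of ps 0 h] by (auto simp: length_Suc_conv dyck_paths_to_def)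
    then show "ps \<in> (if h = 0 then {[(0, 0)]} else {})"
      by simp
  qed
  moreover have "[(0, 0)] \<in> dyck_paths_to (0, 0)"
    by (simp add: dyck_paths_to_def partial_dyck_path_def)
  ultimately show ?thesis
    by (cases "h = 0") auto
qed

lemma path_sum_0: "path_sum a 0 h = (if h = 0 then 1 else 0)"
  by (simp add: path_sum_def dyck_paths_to_0)

lemma snoc_in_dyck_paths_to_iff:
  assumes "ps \<noteq> []"
  shows "ps @ [q] \<in> dyck_paths_to z \<longleftrightarrow>
    q = z \<and> dyck_step (last ps) z \<and> ps \<in> dyck_paths_to (last ps)"
  using assms
  by (auto simp: dyck_paths_to_def partial_dyck_path_def successively_append_iff)

lemma dyck_paths_to_Suc:
  "dyck_paths_to (int (Suc m), h) =
    (\<lambda>ps. ps @ [(int (Suc m), h)]) `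
      ((if h = 0 then {} else dyck_paths_to (int m, h - 1)) \<union> dyck_paths_to (int m, h + 1))"
  (is "_ = ?snoc ` ?A")
proof (intro equalityI subsetI)
  fix qs assume qs: "qs \<in> dyck_paths_to (int (Suc m), h)"
  then obtain ps q where eq: "qs = ps @ [q]" "ps \<noteq> []"
  proof (cases qs rule: rev_cases)
    case (snoc ps q)
    then show ?thesis
      using that length_dyck_path[OF qs] by (cases "ps = []") auto
  qed (use length_dyck_path[OF qs] in simp)
  have *: "q = (int (Suc m), h)" "dyck_step (last ps) (int (Suc m), h)"
    "ps \<in> dyck_paths_to (last ps)"
    using qs snoc_in_dyck_paths_to_iff[OF eq(2)] by (simp_all add: eq)
  have "last ps = (int m, h + 1) \<or> h \<noteq> 0 \<and> last ps = (int m, h - 1)"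
    using *(2) by (cases "last ps") (auto simp: dyck_step_def)
  then have "ps \<in> ?A"
    using *(3) by auto
  then show "qs \<in> ?snoc ` ?A"
    using * eq by simp
next
  fix qs assume "qs \<in> ?snoc ` ?A"
  then obtain ps where ps: "qs = ?snoc ps" "ps \<in> ?A"
    by blast
  then have "dyck_step (last ps) (int (Suc m), h)" "ps \<in> dyck_paths_to (last ps)" "ps \<noteq> []"
    by (auto simp: dyck_paths_to_def partial_dyck_path_def dyck_step_def split: if_splits)
  then show "qs \<in> dyck_paths_to (int (Suc m), h)"
    using snoc_in_dyck_paths_to_iff ps(1) by blast
qed

text \<open>
  Removing the last step is a weight-compatible bijection: a final rise contributes the factor
  \<open>1\<close>, a final fall the factor attached to the height from which it starts.
\<close>

lemma path_sum_Suc: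
  "path_sum a (Suc m) h =
    (if h = 0 then 0 else path_sum a m (h - 1)) + a (h + 1) * path_sum a m (h + 1)"
proof -
  let ?z = "(int (Suc m), h)"
  let ?R = "if h = 0 then {} else dyck_paths_to (int m, h - 1)"
  let ?F = "dyck_paths_to (int m, h + 1)"
  have disjoint: "?R \<inter> ?F = {}"
  proof (rule equals0I)
    fix ps assume "ps \<in> ?R \<inter> ?F"
    then have "last ps = (int m, h - 1)" "last ps = (int m, h + 1)"
      by (auto simp: dyck_paths_to_def split: if_splits)
    then show False
      by simp
  qed
  have "path_sum a (Suc m) h = (\<Sum>ps \<in> ?R \<union> ?F. path_weight a (ps @ [?z]))"
    unfolding path_sum_def dyck_paths_to_Suc by (subst sum.reindex) (auto intro: inj_onI)
  also have "\<dots> = (\<Sum>ps \<in> ?R. path_weight a (ps @ [?z])) + (\<Sum>ps \<in> ?F. path_weight a (ps @ [?z]))"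
    by (intro sum.union_disjoint disjoint) (auto simp: finite_dyck_paths_to)
  also have "(\<Sum>ps \<in> ?R. path_weight a (ps @ [?z])) = (if h = 0 then 0 else path_sum a m (h - 1))"
    by (auto simp: path_sum_def dyck_paths_to_def partial_dyck_path_def
        path_weight_snoc step_weight_def intro!: sum.cong)
  also have "(\<Sum>ps \<in> ?F. path_weight a (ps @ [?z])) = a (h + 1) * path_sum a m (h + 1)"
    by (auto simp: path_sum_def dyck_paths_to_def partial_dyck_path_def sum_distrib_left
        path_weight_snoc step_weight_def mult.commute intro!: sum.cong)
  finally show ?thesis .
qed

lemma path_sum_eq_0: "m < h \<Longrightarrow> path_sum a m h = 0"
  by (induction m arbitrary: h) (auto simp: path_sum_0 path_sum_Suc)

text \<open>
  The recursion links \<open>g\<^bsub>k\<^esub>\<close> to both of its neighbours, so the statements about even and odd \<open>k\<close>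
  have to be proved together. In the induction on \<open>n\<close> the index \<open>k\<close> is arbitrary because the term
  with the factor \<open>t\<close> needs the previous coefficient at \<open>k + 1\<close>; the inner induction on \<open>k\<close>
  supplies the term at \<open>k - 1\<close>.
\<close>

lemma fps_nth_recurrence_eq_path_sum:
  fixes g :: "int \<Rightarrow> 'a::comm_ring_1 fps"
  assumes init: "g (-1) = 1"
    and rec: "\<And>k::nat. g (int k) - g (int k - 1) = fps_const (a (k + 1)) * fps_X * g (int k + 1)"
  shows "fps_nth (g (int k)) n = path_sum a (2 * n + k) k"
proof -
  have g_eq: "g (int k) = g (int k - 1) + fps_X * (fps_const (a (k + 1)) * g (int (Suc k)))" for k
    using rec[of k] by (simp add: algebra_simps)
  show ?thesis
  proof (induction n arbitrary: k)
    case 0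
    show ?case
    proof (induction k)
      case 0
      show ?case
        by (subst g_eq) (simp add: init path_sum_0)
    next
      case (Suc k)
      \<comment> \<open>The term with the factor \<open>t\<close> has no constant coefficient; it corresponds to the fall
        term, which vanishes because no path climbs to height \<open>k + 2\<close> in \<open>k\<close> steps.\<close>
      then show ?case
        by (subst g_eq) (simp add: path_sum_Suc path_sum_eq_0)
    qed
  next
    case (Suc n)
    note IH = Suc.IH
    show ?case
    proof (induction k)
      case 0
      show ?case
        by (subst g_eq) (simp add: init IH[of "Suc 0", simplified] path_sum_Suc[of _ "Suc (2 * n)"])
    next
      case (Suc k)
      then show ?case
        by (subst g_eq) (simp add: IH[of "Suc (Suc k)", simplified]
            path_sum_Suc[of _ "Suc (Suc (2 * n + k))"])
    qed
  qed
qed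

theorem proposition9p2:
  fixes g :: "int \<Rightarrow> zalpha fps"
  assumes "g (-1) = 1"
    and "g 0 = scf alpha"
    and "\<And>k::nat. g (int k) - g (int k - 1) = fps_const (alpha (k + 1)) * fps_X * g (int k + 1)"
  shows "\<forall>j n::nat. fps_nth (g (2 * int j)) n = SR1 alpha (n + j) j
                  \<and> fps_nth (g (2 * int j + 1)) n = SR2 alpha (n + j) j"
proof (intro allI conjI)
  fix j n :: nat
  note coeff = fps_nth_recurrence_eq_path_sum[of g alpha, OF assms(1,3)]
  show "fps_nth (g (2 * int j)) n = SR1 alpha (n + j) j"
    using coeff[of "2 * j" n] by (simp add: SR1_def path_sum_def algebra_simps)
  show "fps_nth (g (2 * int j + 1)) n = SR2 alpha (n + j) j"
    using coeff[of "2 * j + 1" n] by (simp add: SR2_def path_sum_def algebra_simps)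
qed

end
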